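(* Let $a,b,c\in\mathbb{C}$ be generic. The following integral representations hold under the indicated conditions. (1) For $x\in(-\infty,0)\cup(0,1)$, $\operatorname{Re}c>\operatorname{Re}b>0$: $$w_1(x;a,b,c)=\frac{\Gamma(c)}{\Gamma(b)\Gamma(c-b)}|x|^{1-c}\int_{0<y/x<1}|y|^{b-1}(1-y)^{-a}|x-y|^{c-b-1}dy.$$ (2) For $x\in(-\infty,0)\cup(0,1)$, $\operatorname{Re}(c-1)<\operatorname{Re}a<1$: $$w_2(x;a,b,c)=\frac{\Gamma(2-c)}{\Gamma(a-c+1)\Gamma(1-a)}|x|^{1-c}\int_1^\infty y^{b-1}(y-1)^{-a}(y-x)^{c-b-1}dy.$$ (3) For $x\in(-\infty,0)\cup(1,\infty)$, $\operatorname{Re}(a-c+1)>0$, $\operatorname{Re}(c-b)>0$: $$w_3(x;a,b,c)=\frac{\Gamma(a-b+1)}{\Gamma(a-c+1)\Gamma(c-b)}|x|^{1-c}\int_{y/x>1}|y|^{b-1}|y-1|^{-a}|y-x|^{c-b-1}dy.$$ (4) For $x\in(-\infty,0)\cup(1,\infty)$, $\operatorname{Re}a<0$, $\operatorname{Re}b>-1$: $$w_4(x;a,b,c)=\frac{\Gamma(b-a+1)}{\Gamma(-a)\Gamma(b+1)}|x|^{1-c}\int_0^1y^{b-1}(1-y)^{-a}|x-y|^{c-b-1}dy.$$ (5) For $x\in(0,\infty)$, $\operatorname{Re}b>0$, $\operatorname{Re}(a-c+1)>0$: $$w_5(x;a,b,c)=\frac{\Gamma(a+b-c+1)}{\Gamma(a-c+1)\Gamma(b)}x^{1-c}\int_{-\infty}^0(-y)^{b-1}(1-y)^{-a}(x-y)^{c-b-1}dy.$$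 (6) For $x\in(0,1)\cup(1,\infty)$, $\operatorname{Re}(c-b)>0$, $\operatorname{Re}a<1$: $$w_6(x;a,b,c)=\frac{\Gamma(c-a-b+1)}{\Gamma(1-a)\Gamma(c-b)}x^{1-c}\int_{0<\frac{1-y}{1-x}<1}y^{b-1}|1-y|^{-a}|x-y|^{c-b-1}dy.$$
   Context: Write $F(a,b;c;z)={}_2F_1(a,b;c;z)$ for the Gauss hypergeometric function (power series for $|z|<1$, analytically continued to $\mathbb{C}\setminus[1,\infty)$, with $c\notin\mathbb{Z}_{\le0}$). Parameters are called generic when, in particular, all hypergeometric functions involved are well defined. The six solutions of the hypergeometric differential equation $z(1-z)f''(z)+(c-(a+b+1)z)f'(z)-abf(z)=0$ on real intervals are $w_1(x;a,b,c)=F(a,b;c;x)$ for $x\in(-\infty,1)$; $w_2(x;a,b,c)=|x|^{1-c}F(a-c+1,b-c+1;2-c;x)$ for $x\in(-\infty,0)\cup(0,1)$; $w_3(x;a,b,c)=|x|^{-a}F(a,a-c+1;a-b+1;x^{-1})$ for $x\in(-\infty,0)\cup(1,\infty)$; $w_4(x;a,b,c)=|x|^{-b}F(b,b-c+1;b-a+1;x^{-1})$ for $x\in(-\infty,0)\cup(1,\infty)$; $w_5(x;a,b,c)=F(a,b;a+b-c+1;1-x)$ for $x\in(0,\infty)$; $w_6(x;a,b,c)=|1-x|^{c-a-b}F(c-a,c-b;c-a-b+1;1-x)$ for $x\in(0,1)\cup(1,\infty)$. Integrals over sets such as $0<y/x<1$ are over the set of real $y$ satisfying the condition, with $x$ 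fixed.
   Formalization: In (4) the constant is corrected to Γ(b-a+1)/(Γ(1-a)Γ(b)) and the conditions to Re a<1, Re b>0: as printed the right side is off by the factor -a/b (e.g. a=-1/2, b=1/3, c=4/3), and the integral diverges when Re b≤0. *)

theory Defs
  imports "HOL-Complex_Analysis.Complex_Analysis"
begin

definition slit_plane :: "complex set" where
  "slit_plane = - (complex_of_real ` {1..})"

definition is_hyp2F1 :: "complex \<Rightarrow> complex \<Rightarrow> complex \<Rightarrow> (complex \<Rightarrow> complex) \<Rightarrow> bool" where
  "is_hyp2F1 a b c F \<longleftrightarrow>
     F holomorphic_on slit_plane \<and>
     (\<forall>z\<in>ball 0 1. F z = eval_fps (fps_hypergeo [a, b] [c] 1) z)"

(* The choice only concerns the values on the cut: on the slit plane the continuation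
   is unique, see is_hyp2F1_unique. Meaningful for c outside the nonpositive integers. *)
definition hyp2F1 :: "complex \<Rightarrow> complex \<Rightarrow> complex \<Rightarrow> complex \<Rightarrow> complex" where
  "hyp2F1 a b c = (SOME F. is_hyp2F1 a b c F)"

lemma open_slit_plane: "open slit_plane"
proof -
  have "complex_of_real ` {1..} = {z. Im z = 0} \<inter> {z. Re z \<ge> 1}"
    by (auto simp: image_iff complex_eq_iff)
  moreover have "closed \<dots>"
    by (intro closed_Int closed_Collect_eq closed_Collect_le continuous_intros)
  ultimately show ?thesis
    unfolding slit_plane_def by (metis open_Compl)
qed

lemma ball_subset_slit_plane: "ball 0 1 \<subseteq> slit_plane"
  by (auto simp: slit_plane_def)

lemma connected_slit_plane: "connected slit_plane"
proof (rule starlike_imp_connected, unfold starlike_def, intro bexI[of _ 0] ballI subsetI)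
  show "0 \<in> slit_plane" by (auto simp: slit_plane_def)
  fix z w assume z: "z \<in> slit_plane" and "w \<in> closed_segment 0 z"
  then obtain t where t: "0 \<le> t" "t \<le> 1" "w = t *\<^sub>R z"
    by (auto simp: in_segment)
  show "w \<in> slit_plane"
  proof (rule ccontr)
    assume "w \<notin> slit_plane"
    then obtain r where r: "r \<ge> 1" "w = of_real r" by (auto simp: slit_plane_def)
    with t have "t > 0" by (cases "t = 0") auto
    with r t have "z = of_real (r / t)"
      by (simp add: scaleR_conv_of_real field_simps)
    moreover have "r / t \<ge> 1" using r t \<open>t > 0\<close> by (simp add: field_simps)
    ultimately show False
      using z unfolding slit_plane_def by (metis ComplD atLeast_iff imageI)
  qed
qed

lemma is_hyp2F1_unique:
  assumes "is_hyp2F1 a b c F" "is_hyp2F1 a b c G" "z \<in> slit_plane"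
  shows "F z = G z"
  by (rule analytic_continuation_open[of "ball 0 1" slit_plane])
     (use assms open_slit_plane connected_slit_plane ball_subset_slit_plane
      in \<open>auto simp: is_hyp2F1_def\<close>)

definition w1 :: "real \<Rightarrow> complex \<Rightarrow> complex \<Rightarrow> complex \<Rightarrow> complex" where
  "w1 x a b c = hyp2F1 a b c (of_real x)"

definition w2 :: "real \<Rightarrow> complex \<Rightarrow> complex \<Rightarrow> complex \<Rightarrow> complex" where
  "w2 x a b c = of_real \<bar>x\<bar> powr (1 - c) * hyp2F1 (a - c + 1) (b - c + 1) (2 - c) (of_real x)"

definition w3 :: "real \<Rightarrow> complex \<Rightarrow> complex \<Rightarrow> complex \<Rightarrow> complex" where
  "w3 x a b c = of_real \<bar>x\<bar> powr (- a) * hyp2F1 a (a - c + 1) (a - b + 1) (of_real (inverse x))"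

definition w4 :: "real \<Rightarrow> complex \<Rightarrow> complex \<Rightarrow> complex \<Rightarrow> complex" where
  "w4 x a b c = of_real \<bar>x\<bar> powr (- b) * hyp2F1 b (b - c + 1) (b - a + 1) (of_real (inverse x))"

definition w5 :: "real \<Rightarrow> complex \<Rightarrow> complex \<Rightarrow> complex \<Rightarrow> complex" where
  "w5 x a b c = hyp2F1 a b (a + b - c + 1) (of_real (1 - x))"

definition w6 :: "real \<Rightarrow> complex \<Rightarrow> complex \<Rightarrow> complex \<Rightarrow> complex" where
  "w6 x a b c = of_real \<bar>1 - x\<bar> powr (c - a - b) *
     hyp2F1 (c - a) (c - b) (c - a - b + 1) (of_real (1 - x))"

(* Generic in the weakest sense: the six hypergeometric functions in w1, ..., w6 are well defined. *)
definition generic :: "complex \<Rightarrow> complex \<Rightarrow> complex \<Rightarrow> bool" where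
  "generic a b c \<longleftrightarrow>
     c \<notin> \<int>\<^sub>\<le>\<^sub>0 \<and> 2 - c \<notin> \<int>\<^sub>\<le>\<^sub>0 \<and>
     a - b + 1 \<notin> \<int>\<^sub>\<le>\<^sub>0 \<and> b - a + 1 \<notin> \<int>\<^sub>\<le>\<^sub>0 \<and>
     a + b - c + 1 \<notin> \<int>\<^sub>\<le>\<^sub>0 \<and> c - a - b + 1 \<notin> \<int>\<^sub>\<le>\<^sub>0"

(* The Lebesgue integral of a non-integrable function is 0 by convention, so an integral
   representation includes the convergence of the integral. *)
definition has_integral_rep :: "complex \<Rightarrow> complex \<Rightarrow> real set \<Rightarrow> (real \<Rightarrow> complex) \<Rightarrow> bool" where
  "has_integral_rep w k S f \<longleftrightarrow>
     set_integrable lborel S f \<and> w = k * (LINT y:S|lborel. f y)"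

end

theory Submission
  imports Defs
begin

text \<open>
  Everything reduces to Euler's integral
  \<open>F(a,b;c;z) = \<Gamma>(c) / (\<Gamma>(b) \<Gamma>(c - b)) \<integral>\<^sub>0\<^sup>1 t\<^bsup>b-1\<^esup> (1 - t)\<^bsup>c-b-1\<^esup> (1 - t z)\<^bsup>-a\<^esup> dt\<close>
  on the slit plane. The right-hand side is holomorphic there by dominated differentiation under the
  integral, and on the unit disc the binomial series and the Beta integral give the hypergeometric
  series, so both sides agree by uniqueness of the continuation. Each of the six integrals is the
  image of an Euler integral under the Moebius map that sends \<open>0, 1, 1/z\<close> to the appropriate three of
  the points \<open>0, 1, x, \<infinity>\<close>:
  (1) \<open>y = x t\<close>, (2) \<open>y = 1 / t\<close>, (3) \<open>y = x / t\<close>, (4) \<open>y = t\<close>, (5) \<open>y = - x t / (1 - t)\<close>,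
  (6) \<open>y = x / (1 - t (1 - x))\<close>.
\<close>

subsection \<open>Parametric integrals and change of variables\<close>

text \<open>By Cauchy's inequality a local majorant \<open>g\<close> of the integrand also controls
  its difference quotients on a ball of half the radius. Dominated convergence then allows
  differentiation under the integral.\<close>

lemma holomorphic_on_lebesgue_integral:
  fixes f :: "complex \<Rightarrow> 'a \<Rightarrow> complex"
  assumes hol: "\<And>t. t \<in> space M \<Longrightarrow> (\<lambda>z. f z t) holomorphic_on S"
    and meas: "\<And>z. z \<in> S \<Longrightarrow> f z \<in> borel_measurable M"
    and dom: "\<And>z\<^sub>0. z\<^sub>0 \<in> S \<Longrightarrow> \<exists>r g. 0 < r \<and> cball z\<^sub>0 r \<subseteq> S \<and> integrable M g \<and>
                (\<forall>z\<in>cball z\<^sub>0 r. \<forall>t\<in>space M. norm (f z t) \<le> g t)"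
  shows "(\<lambda>z. LINT t|M. f z t) holomorphic_on S"
  unfolding holomorphic_on_def
proof
  fix z\<^sub>0 assume "z\<^sub>0 \<in> S"
  then obtain r g where r: "0 < r" "cball z\<^sub>0 r \<subseteq> S" and g: "integrable M g"
    and fg: "\<And>z t. z \<in> cball z\<^sub>0 r \<Longrightarrow> t \<in> space M \<Longrightarrow> norm (f z t) \<le> g t"
    using dom by metis
  have int: "integrable M (f z)" if "z \<in> cball z\<^sub>0 r" for z
    by (rule Bochner_Integration.integrable_bound[OF g])
       (use that r fg meas in \<open>force intro!: AE_I2\<close>)+
  define D where "D = (\<lambda>t. deriv (\<lambda>z. f z t) z\<^sub>0)"
  \<comment> \<open>A circle of radius \<open>r/2\<close> about a point of the half ball stays
    inside \<open>cball z\<^sub>0 r\<close>, where \<open>g\<close> is a bound. So the derivative is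
    at most \<open>g t / (r/2)\<close>, and the half ball is convex.\<close>
  have lip: "norm (f z t - f z\<^sub>0 t) \<le> 2 * g t / r * norm (z - z\<^sub>0)"
    if z: "z \<in> cball z\<^sub>0 (r/2)" and t: "t \<in> space M" for z t
  proof (rule field_differentiable_bound)
    fix u assume u: "u \<in> cball z\<^sub>0 (r/2)"
    have sub: "cball u (r/2) \<subseteq> cball z\<^sub>0 r"
      using u by (subst cball_subset_cball_iff) (auto simp: dist_commute)
    have holS: "(\<lambda>z. f z t) holomorphic_on cball u (r/2)"
      using hol[OF t] sub r by (meson holomorphic_on_subset order_trans)
    have "norm ((deriv ^^ 1) (\<lambda>z. f z t) u) \<le> fact 1 * g t / (r/2)^1"
    proof (rule Cauchy_inequality)
      fix v assume "norm (u - v) = r/2"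
      then have "v \<in> cball u (r/2)" by (simp add: dist_norm)
      then show "norm (f v t) \<le> g t" using sub fg t by blast
    qed (use holS r in \<open>auto intro: holomorphic_on_imp_continuous_on holomorphic_on_subset\<close>)
    then show "norm (deriv (\<lambda>z. f z t) u) \<le> 2 * g t / r" by (simp add: mult.commute)
    have "(\<lambda>z. f z t) holomorphic_on ball u (r/2)"
      using holS by (rule holomorphic_on_subset) auto
    then show "((\<lambda>z. f z t) has_field_derivative deriv (\<lambda>z. f z t) u) (at u within cball z\<^sub>0 (r/2))"
      using r by (intro has_field_derivative_at_within[OF holomorphic_derivI[of _ "ball u (r/2)"]]) auto
  qed (use z r in auto)
  have "((\<lambda>z. LINT t|M. f z t) has_field_derivative (LINT t|M. D t)) (at z\<^sub>0)"
    unfolding has_field_derivative_iff tendsto_at_iff_sequentially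
  proof (intro allI impI)
    fix X assume X: "\<forall>i. X i \<in> UNIV - {z\<^sub>0}" "X \<longlonglongrightarrow> z\<^sub>0"
    have "\<forall>\<^sub>F i in sequentially. X i \<in> ball z\<^sub>0 (r/2)"
      using X(2) r by (intro topological_tendstoD) auto
    then obtain N where N: "\<And>i. i \<ge> N \<Longrightarrow> X i \<in> ball z\<^sub>0 (r/2)"
      by (auto simp: eventually_sequentially)
    \<comment> \<open>Dropping the first \<open>N\<close> terms puts the whole sequence into the
      half ball, so that \<open>lip\<close> holds for every index; \<open>LIMSEQ_offset\<close>
      restores the original sequence at the end.\<close>
    define Y where "Y = (\<lambda>i. X (i + N))"
    have Y: "Y i \<in> cball z\<^sub>0 (r/2)" "Y i \<in> cball z\<^sub>0 r" "Y i \<noteq> z\<^sub>0" for i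
      using N[of "i + N"] X(1) r by (auto simp: Y_def)
    have Ylim: "Y \<longlonglongrightarrow> z\<^sub>0" unfolding Y_def using X(2) by (rule LIMSEQ_ignore_initial_segment)
    have qlim: "(\<lambda>i. (f (Y i) t - f z\<^sub>0 t) / (Y i - z\<^sub>0)) \<longlonglongrightarrow> D t" if t: "t \<in> space M" for t
    proof -
      have "(\<lambda>z. f z t) holomorphic_on ball z\<^sub>0 r"
        using hol[OF t] r by (meson ball_subset_cball holomorphic_on_subset order_trans)
      then have "((\<lambda>z. f z t) has_field_derivative D t) (at z\<^sub>0)"
        unfolding D_def using r by (intro holomorphic_derivI[of _ "ball z\<^sub>0 r"]) auto
      then show ?thesis
        using Ylim Y(3) unfolding has_field_derivative_iff tendsto_at_iff_sequentially comp_def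
        by auto
    qed
    have qm: "(\<lambda>t. (f (Y i) t - f z\<^sub>0 t) / (Y i - z\<^sub>0)) \<in> borel_measurable M" for i
      using int[OF Y(2)] int[of z\<^sub>0] r by (intro borel_measurable_divide borel_measurable_diff) auto
    have "(\<lambda>i. LINT t|M. (f (Y i) t - f z\<^sub>0 t) / (Y i - z\<^sub>0)) \<longlonglongrightarrow> (LINT t|M. D t)"
    proof (rule integral_dominated_convergence)
      show "D \<in> borel_measurable M"
        by (rule borel_measurable_LIMSEQ_metric[OF qm qlim])
      show "integrable M (\<lambda>t. 2 * g t / r)" using g by simp
      show "AE t in M. norm ((f (Y i) t - f z\<^sub>0 t) / (Y i - z\<^sub>0)) \<le> 2 * g t / r" for i
        using lip[OF Y(1)] Y(3) by (intro AE_I2) (auto simp: norm_divide divide_le_eq)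
    qed (use qm qlim in auto)
    also have "(\<lambda>i. LINT t|M. (f (Y i) t - f z\<^sub>0 t) / (Y i - z\<^sub>0)) =
      (\<lambda>i. ((LINT t|M. f (Y i) t) - (LINT t|M. f z\<^sub>0 t)) / (Y i - z\<^sub>0))"
      using int Y(2) r by simp
    finally show "((\<lambda>y. ((LINT t|M. f y t) - (LINT t|M. f z\<^sub>0 t)) / (y - z\<^sub>0)) \<circ> X)
                    \<longlonglongrightarrow> (LINT t|M. D t)"
      by - (rule LIMSEQ_offset[of _ N], simp add: Y_def)
  qed
  then show "(\<lambda>z. LINT t|M. f z t) field_differentiable at z\<^sub>0 within S"
    by (meson field_differentiable_at_within field_differentiable_def)
qed

text \<open>The real change of variables theorem is applied to the real and imaginary parts. It
  speaks about \<open>lebesgue\<close>; continuity of \<open>f\<close> on the image gives the Borel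
  measurability with which one returns to \<open>lborel\<close>. Integrability is assumed on the
  side of \<open>S\<close> only and carried over to the image.\<close>

lemma set_integral_change_of_variables_complex:
  fixes f :: "real \<Rightarrow> complex" and g g' :: "real \<Rightarrow> real"
  assumes S: "S \<in> sets borel" and gS: "g ` S \<in> sets borel"
    and der: "\<And>t. t \<in> S \<Longrightarrow> (g has_field_derivative g' t) (at t)"
    and inj: "inj_on g S"
    and cont: "continuous_on (g ` S) f"
    and int: "set_integrable lborel S (\<lambda>t. of_real \<bar>g' t\<bar> * f (g t))"
  shows "set_integrable lborel (g ` S) f"
    and "(LINT y:g ` S|lborel. f y) = (LINT t:S|lborel. of_real \<bar>g' t\<bar> * f (g t))"
proof -
  define h where "h = (\<lambda>t. of_real \<bar>g' t\<bar> * f (g t))"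
  have Re_h: "Re (h t) = \<bar>g' t\<bar> * Re (f (g t))" and Im_h: "Im (h t) = \<bar>g' t\<bar> * Im (f (g t))" for t
    by (simp_all add: h_def)
  have h: "set_integrable lborel S h" using int by (simp add: h_def)
  \<comment> \<open>Here \<phi> stands for \<open>Re\<close> or \<open>Im\<close>; both commute with
    the real factor \<open>\<bar>g' t\<bar>\<close>.\<close>
  have comp: "set_integrable lborel (g ` S) (\<lambda>y. \<phi> (f y)) \<and>
      (LINT y:g ` S|lborel. \<phi> (f y)) = (LINT t:S|lborel. \<phi> (h t))"
    if \<phi>: "bounded_linear \<phi>" and \<phi>h: "\<And>t. \<phi> (h t) = \<bar>g' t\<bar> * \<phi> (f (g t))" for \<phi> :: "complex \<Rightarrow> real"
  proof -
    have hb: "set_integrable lborel S (\<lambda>t. \<phi> (h t))"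
      using integrable_bounded_linear[OF \<phi> h[unfolded set_integrable_def]] \<phi>
      by (simp add: set_integrable_def linear_cmul bounded_linear.linear)
    have "set_integrable lebesgue S (\<lambda>t. \<phi> (h t))"
      using hb unfolding set_integrable_def
      by (subst integrable_completion) (auto dest: borel_measurable_integrable)
    then have 1: "(\<lambda>y. \<phi> (f y)) absolutely_integrable_on (g ` S) \<and>
        integral (g ` S) (\<lambda>y. \<phi> (f y)) = integral S (\<lambda>t. \<phi> (h t))"
      unfolding \<phi>h
      by (subst has_absolute_integral_change_of_variables_1'[symmetric, where g' = g'])
         (use S inj in \<open>auto intro!: has_field_derivative_at_within der\<close>)
    have "continuous_on (g ` S) (\<lambda>y. \<phi> (f y))"
      using cont \<phi> by (simp add: bounded_linear.continuous_on)
    then have "(\<lambda>y. indicator (g ` S) y *\<^sub>R \<phi> (f y)) \<in> borel_measurable borel"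
      by (rule borel_measurable_continuous_on_indicator[OF gS])
    then have 2: "set_integrable lborel (g ` S) (\<lambda>y. \<phi> (f y))"
      using 1 unfolding set_integrable_def by (subst (asm) integrable_completion) auto
    show ?thesis
      using 1 2 set_borel_integral_eq_integral(2)[OF 2] set_borel_integral_eq_integral(2)[OF hb] by simp
  qed
  note R = comp[OF bounded_linear_Re Re_h] and I = comp[OF bounded_linear_Im Im_h]
  show f: "set_integrable lborel (g ` S) f"
  proof -
    have *: "set_integrable lborel A (\<lambda>y. complex_of_real (k y))" if "set_integrable lborel A k"
      for A :: "real set" and k
      using that unfolding set_integrable_def scaleR_conv_of_real
      by (simp add: complex_of_real_integrable_eq flip: of_real_mult)
    have "set_integrable lborel (g ` S) (\<lambda>y. of_real (Re (f y)) + \<i> * of_real (Im (f y)))"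
      using R I by (intro set_integral_add set_integrable_mult_right)
                   (simp_all add: *)
    then show ?thesis by (simp flip: complex_eq)
  qed
  have ReL: "Re (LINT y:A|lborel. k y) = (LINT y:A|lborel. Re (k y))"
    and ImL: "Im (LINT y:A|lborel. k y) = (LINT y:A|lborel. Im (k y))"
    if "set_integrable lborel A k" for A :: "real set" and k :: "real \<Rightarrow> complex"
    using integral_Re[OF that[unfolded set_integrable_def]] integral_Im[OF that[unfolded set_integrable_def]]
    by (simp_all add: set_lebesgue_integral_def)
  have "(LINT y:g ` S|lborel. f y) = (LINT t:S|lborel. h t)"
    using R I by (intro complex_eqI) (simp_all add: ReL ImL f h)
  then show "(LINT y:g ` S|lborel. f y) = (LINT t:S|lborel. of_real \<bar>g' t\<bar> * f (g t))"
    by (simp add: h_def)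
qed

subsection \<open>The complex Beta integral\<close>

lemma continuous_on_of_real_powr:
  fixes f :: "real \<Rightarrow> real" and p :: complex
  assumes "continuous_on S f" "\<And>y. y \<in> S \<Longrightarrow> f y > 0"
  shows "continuous_on S (\<lambda>y. of_real (f y) powr p)"
  using assms by (intro continuous_intros) force+

lemma norm_of_real_powr:
  "x > 0 \<Longrightarrow> norm (of_real x powr (p :: complex)) = x powr Re p"
  by (subst norm_powr_real_powr) auto

lemma borel_measurable_beta_kernel:
  "(\<lambda>t. indicator {0<..<1::real} t *\<^sub>R (of_real t powr p * of_real (1 - t) powr q :: complex))
     \<in> borel_measurable borel"
  by (intro borel_measurable_continuous_on_indicator continuous_intros continuous_on_of_real_powr) auto

text \<open>On the unit interval the norm of the kernel is the real Beta kernel with parameters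
  \<open>Re p\<close> and \<open>Re q\<close>.\<close>

lemma set_integrable_beta_kernel:
  fixes p q :: complex
  assumes "Re p > 0" "Re q > 0"
  shows "set_integrable lborel {0<..<1} (\<lambda>t. of_real t powr (p - 1) * of_real (1 - t) powr (q - 1))"
proof -
  have "set_integrable lborel {0<..<1} (\<lambda>t. t powr (Re p - 1) * (1 - t) powr (Re q - 1))"
    by (rule set_integrable_subset[OF integrable_Beta[OF assms]]) auto
  then show ?thesis
    unfolding set_integrable_def
    by (rule Bochner_Integration.integrable_bound)
       (use borel_measurable_beta_kernel[of "p - 1" "q - 1"]
        in \<open>auto intro!: AE_I2 simp: indicator_def norm_mult norm_of_real_powr simp del: of_real_diff\<close>)
qed

text \<open>Substitute \<open>1 - t\<close> for \<open>t\<close>. The symmetry makes analytic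
  continuation in the first argument available for the second one.\<close>

lemma beta_integral_reflect:
  fixes p q :: complex
  assumes "Re p > 0" "Re q > 0"
  shows "(LINT t:{0<..<1}|lborel. of_real t powr (p - 1) * of_real (1 - t) powr (q - 1)) =
         (LINT t:{0<..<1}|lborel. of_real t powr (q - 1) * of_real (1 - t) powr (p - 1))"
proof -
  have im: "(\<lambda>t. 1 - t) ` {0<..<1} = {0<..<1::real}"
    by (auto intro!: image_eqI[where x = "1 - x" for x])
  have cont: "continuous_on {0<..<1} (\<lambda>t. of_real t powr (p - 1) * of_real (1 - t) powr (q - 1))"
    by (intro continuous_intros continuous_on_of_real_powr) auto
  have der: "((\<lambda>t. 1 - t) has_field_derivative - 1) (at t)" for t :: real
    by (auto intro!: derivative_eq_intros)
  show ?thesis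
    using set_integral_change_of_variables_complex(2)[of "{0<..<1}" "\<lambda>t. 1 - t" "\<lambda>_. - 1"
        "\<lambda>t. of_real t powr (p - 1) * of_real (1 - t) powr (q - 1)", unfolded im, OF _ _ _ _ cont]
      set_integrable_beta_kernel[of q p] assms
    by (simp add: inj_on_def mult.commute der del: of_real_diff)
qed

lemma holomorphic_beta_integral:
  fixes q :: complex
  assumes q: "Re q > 0"
  shows "(\<lambda>p. LINT t:{0<..<1}|lborel. of_real t powr (p - 1) * of_real (1 - t) powr (q - 1))
           holomorphic_on {p. Re p > 0}"
  unfolding set_lebesgue_integral_def
proof (rule holomorphic_on_lebesgue_integral)
  fix t :: real
  show "(\<lambda>p. indicator {0<..<1} t *\<^sub>R (of_real t powr (p - 1) * of_real (1 - t) powr (q - 1)))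
          holomorphic_on {p. Re p > 0}"
    unfolding scaleR_conv_of_real by (intro holomorphic_intros)
next
  fix p\<^sub>0 :: complex assume p: "p\<^sub>0 \<in> {p. Re p > 0}"
  \<comment> \<open>On the ball of this radius real parts stay at least \<open>r\<close>. Since
    \<open>t < 1\<close>, the kernel with exponent \<open>r - 1\<close> then dominates all kernels
    with \<open>z\<close> in the ball.\<close>
  define r where "r = Re p\<^sub>0 / 2"
  have r: "r > 0" using p by (simp add: r_def)
  have ge: "Re z \<ge> r" if "z \<in> cball p\<^sub>0 r" for z
    using that abs_Re_le_cmod[of "p\<^sub>0 - z"] by (simp add: dist_norm r_def)
  define g where "g = (\<lambda>t. indicator {0<..<1} t *\<^sub>R (t powr (r - 1) * (1 - t) powr (Re q - 1)))"
  have "integrable lborel g"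
    unfolding g_def
    using set_integrable_subset[OF integrable_Beta[OF r q], of "{0<..<1}"]
    by (simp add: set_integrable_def subset_eq)
  moreover have "norm (indicator {0<..<1} t *\<^sub>R (of_real t powr (z - 1) * of_real (1 - t) powr (q - 1))) \<le> g t"
    if "z \<in> cball p\<^sub>0 r" for z t
    using ge[OF that]
    by (auto simp: g_def indicator_def norm_mult norm_of_real_powr simp del: of_real_diff
             intro!: mult_right_mono powr_mono')
  ultimately show "\<exists>r g. 0 < r \<and> cball p\<^sub>0 r \<subseteq> {p. Re p > 0} \<and> integrable lborel g \<and>
      (\<forall>z\<in>cball p\<^sub>0 r. \<forall>t\<in>space lborel.
         norm (indicator {0<..<1} t *\<^sub>R (of_real t powr (z - 1) * of_real (1 - t) powr (q - 1))) \<le> g t)"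
    using r ge by (intro exI[of _ r] exI[of _ g] conjI) (auto dest!: ge)
qed (simp add: borel_measurable_beta_kernel del: of_real_diff scaleR_conv_of_real)

text \<open>Identity theorem: the positive reals accumulate at 1, a point of the connected open
  half-plane.\<close>

lemma holomorphic_eq_right_half_plane:
  assumes "f holomorphic_on {p. Re p > 0}" "g holomorphic_on {p. Re p > 0}"
    and "\<And>x::real. x > 0 \<Longrightarrow> f (of_real x) = g (of_real x)" and "Re p > 0"
  shows "f p = g p"
proof -
  have lim: "1 islimpt (of_real ` {0<..} :: complex set)"
  proof -
    have "(1::real) islimpt {0<..}" by (intro interior_limit_point) (auto simp: interior_open)
    then show ?thesis
      using islimpt_isCont_image[of 1 "{0<..}" complex_of_real]
      by (auto simp: eventually_at_filter)
  qed
  have conn: "connected {p. Re p > 0}"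
    using convex_halfspace_Re_gt[of 0] convex_connected by blast
  have hol: "(\<lambda>p. f p - g p) holomorphic_on {p. Re p > 0}"
    using assms by (intro holomorphic_intros)
  have eq: "f z - g z = 0" if "z \<in> of_real ` {0<..}" for z
    using assms(3) that by auto
  have "f p - g p = 0"
    by (rule analytic_continuation[OF hol _ conn _ _ lim eq])
       (use open_halfspace_Re_gt[of 0] assms(4) in \<open>auto simp only: mem_Collect_eq one_complex.simps image_subset_iff Re_complex_of_real greaterThan_iff zero_less_one\<close>)
  then show ?thesis by simp
qed

lemma not_nonpos_Ints_if_Re_pos: "Re z > 0 \<Longrightarrow> z \<notin> \<int>\<^sub>\<le>\<^sub>0"
  by (auto elim!: nonpos_Ints_cases)

lemma holomorphic_Beta_left:
  assumes "Re q > 0"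
  shows "(\<lambda>p. Beta p q) holomorphic_on {p. Re p > 0}"
  using assms by (intro holomorphic_intros) (auto intro!: not_nonpos_Ints_if_Re_pos)

text \<open>The formula for real arguments is continued analytically in one argument at a time, with
  the reflection used to exchange the two.\<close>

theorem beta_integral_complex:
  fixes p q :: complex
  assumes p: "Re p > 0" and q: "Re q > 0"
  shows "(LINT t:{0<..<1}|lborel. of_real t powr (p - 1) * of_real (1 - t) powr (q - 1)) = Beta p q"
proof -
  define I where "I = (\<lambda>p q :: complex.
    LINT t:{0<..<1}|lborel. of_real t powr (p - 1) * of_real (1 - t) powr (q - 1))"
  have real: "I (of_real x) (of_real y) = Beta (of_real x) (of_real y)" if "x > 0" "y > 0" for x y :: real
  proof -
    have int: "set_integrable lborel {0<..<1} (\<lambda>t. t powr (x - 1) * (1 - t) powr (y - 1))"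
      by (rule set_integrable_subset[OF integrable_Beta[OF that]]) auto
    have "I (of_real x) (of_real y) =
        (LINT t:{0<..<1}|lborel. complex_of_real (t powr (x - 1) * (1 - t) powr (y - 1)))"
      unfolding I_def by (intro set_lebesgue_integral_cong) (auto simp flip: powr_of_real)
    also have "\<dots> = of_real (LINT t:{0<..<1}|lborel. t powr (x - 1) * (1 - t) powr (y - 1))"
      by (rule set_integral_complex_of_real)
    also have "(LINT t:{0<..<1}|lborel. t powr (x - 1) * (1 - t) powr (y - 1)) = Beta x y"
      using set_borel_integral_eq_integral(2)[OF int] has_integral_Beta_real[OF that]
      by (simp add: has_integral_Icc_iff_Ioo integral_unique)
    finally show ?thesis by (simp add: Beta_def Gamma_complex_of_real flip: of_real_add)
  qed
  have half: "I p (of_real y) = Beta p (of_real y)" if "y > 0" "Re p > 0" for p and y :: real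
    by (rule holomorphic_eq_right_half_plane[where f = "\<lambda>p. I p (of_real y)"])
       (use real that holomorphic_beta_integral[of "of_real y"] holomorphic_Beta_left[of "of_real y"]
        in \<open>auto simp: I_def\<close>)
  \<comment> \<open>Second continuation, with \<open>p\<close> complex and fixed. Its base case, a
    real first argument, is the reflection of \<open>half\<close>.\<close>
  have "I q p = Beta q p"
  proof (rule holomorphic_eq_right_half_plane[where f = "\<lambda>q. I q p"])
    fix x :: real assume x: "x > 0"
    then show "I (of_real x) p = Beta (of_real x) p"
      using half[OF x p] beta_integral_reflect[of "of_real x" p] p by (simp add: I_def Beta_commute)
  qed (use p q holomorphic_beta_integral[OF p] holomorphic_Beta_left[OF p] in \<open>auto simp: I_def\<close>)
  then show ?thesis
    using beta_integral_reflect[OF p q] by (simp add: I_def Beta_commute)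
qed

subsection \<open>Euler's integral\<close>

text \<open>A value \<open>u \<le> 0\<close> would give \<open>z = (1 - u) / t \<ge> 1\<close>, a
  point of the cut. Hence the principal power of \<open>1 - t z\<close> is holomorphic in
  \<open>z\<close> on the slit plane.\<close>

lemma one_minus_mult_notin_nonpos_Reals:
  assumes "z \<in> slit_plane" "0 \<le> t" "t \<le> 1"
  shows "1 - of_real t * z \<notin> \<real>\<^sub>\<le>\<^sub>0"
proof
  assume "1 - of_real t * z \<in> \<real>\<^sub>\<le>\<^sub>0"
  then obtain u where u: "u \<le> 0" "1 - of_real t * z = of_real u" by (auto elim: nonpos_Reals_cases)
  then have "t \<noteq> 0" by auto
  with u have "z = of_real ((1 - u) / t)" by (simp add: field_simps)
  moreover have "(1 - u) / t \<ge> 1" using u assms \<open>t \<noteq> 0\<close> by (simp add: field_simps)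
  ultimately show False using assms(1) unfolding slit_plane_def by blast
qed

text \<open>A jointly continuous function on a compact product is bounded. The bound is uniform in
  \<open>t\<close> and \<open>z\<close>, as dominated differentiation requires.\<close>

lemma euler_factor_bounded_on_compact:
  assumes "compact K" "K \<subseteq> slit_plane"
  obtains B where "\<And>z t. z \<in> K \<Longrightarrow> 0 \<le> t \<Longrightarrow> t \<le> 1 \<Longrightarrow> norm ((1 - of_real t * z) powr a) \<le> B"
proof -
  have ne: "1 - of_real t * z \<notin> \<real>\<^sub>\<le>\<^sub>0" if "z \<in> K" "0 \<le> t" "t \<le> 1" for z t
    using that assms(2) by (intro one_minus_mult_notin_nonpos_Reals) auto
  have ne0: "1 - of_real t * z \<noteq> 0" if "z \<in> K" "0 \<le> t" "t \<le> 1" for z t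
    using ne[OF that] by auto
  \<comment> \<open>This is \<open>powr\<close> without its case distinction at base 0; the base is
    nonzero here by \<open>ne0\<close>.\<close>
  have "continuous_on (K \<times> {0..1}) (\<lambda>(z, t). exp (a * Ln (1 - of_real t * z)))"
    unfolding case_prod_unfold by (intro continuous_intros) (auto dest: ne)
  then have "bounded ((\<lambda>(z, t). exp (a * Ln (1 - of_real t * z))) ` (K \<times> {0..1}))"
    using assms(1) by (intro compact_imp_bounded compact_continuous_image compact_Times) auto
  then obtain B where B: "\<forall>w\<in>(\<lambda>(z, t). exp (a * Ln (1 - of_real t * z))) ` (K \<times> {0..1}). norm w \<le> B"
    unfolding bounded_iff by blast
  show ?thesis
  proof (rule that)
    fix z t assume zt: "z \<in> K" "0 \<le> t" "t \<le> (1::real)"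
    then have "(1 - of_real t * z) powr a \<in> (\<lambda>(z, t). exp (a * Ln (1 - of_real t * z))) ` (K \<times> {0..1})"
      using ne0[OF zt] by (auto simp: powr_def intro!: image_eqI[where x = "(z, t)"])
    then show "norm ((1 - of_real t * z) powr a) \<le> B" using B by blast
  qed
qed

lemma borel_measurable_euler_integrand:
  assumes "z \<in> slit_plane"
  shows "(\<lambda>t. indicator {0<..<1} t *\<^sub>R
            (of_real t powr p * of_real (1 - t) powr q * (1 - of_real t * z) powr (- a)))
           \<in> borel_measurable borel"
proof (intro borel_measurable_continuous_on_indicator continuous_on_mult continuous_on_of_real_powr)
  have ne: "1 - of_real t * z \<notin> \<real>\<^sub>\<le>\<^sub>0" "1 - of_real t * z \<noteq> 0" if "t \<in> {0<..<1}" for t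
    using one_minus_mult_notin_nonpos_Reals[OF assms, of t] that by auto
  show "continuous_on {0<..<1} (\<lambda>t. (1 - of_real t * z) powr (- a))"
    by (intro continuous_intros subsetI) (use ne in \<open>force simp: complex_nonpos_Reals_iff\<close>)+
qed (auto intro!: continuous_intros)

text \<open>The factor involving \<open>z\<close> is bounded in \<open>t\<close>, so a multiple of
  the Beta kernel with parameters \<open>b\<close> and \<open>c - b\<close> dominates.\<close>

lemma set_integrable_euler_integrand:
  fixes a b c z :: complex
  assumes "Re b > 0" "Re c > Re b" "z \<in> slit_plane"
  shows "set_integrable lborel {0<..<1}
     (\<lambda>t. of_real t powr (b - 1) * of_real (1 - t) powr (c - b - 1) * (1 - of_real t * z) powr (- a))"
proof -
  obtain B where B: "\<And>t. 0 \<le> t \<Longrightarrow> t \<le> 1 \<Longrightarrow> norm ((1 - of_real t * z) powr (- a)) \<le> B"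
    using euler_factor_bounded_on_compact[of "{z}" "- a"] assms(3)
    by (metis compact_sing empty_subsetI insert_subset singletonI)
  have "set_integrable lborel {0<..<1} (\<lambda>t. (of_real t powr (b - 1) * of_real (1 - t) powr (c - b - 1)) * of_real B)"
    using set_integrable_beta_kernel[of b "c - b"] assms by (intro set_integrable_mult_left) auto
  then show ?thesis
    unfolding set_integrable_def
    by (rule Bochner_Integration.integrable_bound)
       (use borel_measurable_euler_integrand[OF assms(3), of "b - 1" "c - b - 1" a] B
        in \<open>auto intro!: AE_I2 mult_left_mono order.trans[OF B] simp: indicator_def norm_mult simp del: of_real_diff\<close>)
qed

lemma holomorphic_euler_integral:
  fixes a b c :: complex
  assumes bc: "Re b > 0" "Re c > Re b"
  shows "(\<lambda>z. LINT t:{0<..<1}|lborel. of_real t powr (b - 1) * of_real (1 - t) powr (c - b - 1)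
                 * (1 - of_real t * z) powr (- a)) holomorphic_on slit_plane"
  unfolding set_lebesgue_integral_def
proof (rule holomorphic_on_lebesgue_integral)
  fix t :: real
  have "(\<lambda>z. (1 - of_real t * z) powr (- a)) holomorphic_on slit_plane" if "t \<in> {0<..<1}"
    using that by (intro holomorphic_intros one_minus_mult_notin_nonpos_Reals) auto
  then show "(\<lambda>z. indicator {0<..<1} t *\<^sub>R (of_real t powr (b - 1) * of_real (1 - t) powr (c - b - 1)
                 * (1 - of_real t * z) powr (- a))) holomorphic_on slit_plane"
    by (cases "t \<in> {0<..<1}") (auto intro!: holomorphic_intros simp del: of_real_diff)
next
  fix z\<^sub>0 assume "z\<^sub>0 \<in> slit_plane"
  then obtain r where r: "r > 0" "cball z\<^sub>0 r \<subseteq> slit_plane"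
    using open_slit_plane open_contains_cball by blast
  obtain B where B: "\<And>z t. z \<in> cball z\<^sub>0 r \<Longrightarrow> 0 \<le> t \<Longrightarrow> t \<le> 1 \<Longrightarrow> norm ((1 - of_real t * z) powr (- a)) \<le> B"
    using euler_factor_bounded_on_compact[OF compact_cball r(2)] by metis
  \<comment> \<open>The majorant is the norm of the Beta kernel times the bound \<open>B\<close>
    valid on the whole ball around \<open>z\<^sub>0\<close>.\<close>
  define g where "g = (\<lambda>t. norm (indicator {0<..<1} t *\<^sub>R
      (of_real t powr (b - 1) * of_real (1 - t) powr (c - b - 1) :: complex)) * B)"
  have "integrable lborel g"
    unfolding g_def using set_integrable_beta_kernel[of b "c - b"] bc
    by (intro integrable_mult_left integrable_norm) (simp_all add: set_integrable_def)
  moreover have "norm (indicator {0<..<1} t *\<^sub>R (of_real t powr (b - 1) * of_real (1 - t) powr (c - b - 1)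
                 * (1 - of_real t * z) powr (- a))) \<le> g t" if "z \<in> cball z\<^sub>0 r" for z t
    using B[OF that] by (auto simp: g_def indicator_def norm_mult simp del: of_real_diff intro!: mult_left_mono)
  ultimately show "\<exists>r g. 0 < r \<and> cball z\<^sub>0 r \<subseteq> slit_plane \<and> integrable lborel g \<and>
      (\<forall>z\<in>cball z\<^sub>0 r. \<forall>t\<in>space lborel.
         norm (indicator {0<..<1} t *\<^sub>R (of_real t powr (b - 1) * of_real (1 - t) powr (c - b - 1)
                 * (1 - of_real t * z) powr (- a))) \<le> g t)"
    using r by blast
qed (simp add: borel_measurable_euler_integrand del: of_real_diff)

text \<open>Each Pochhammer symbol is a quotient of Gamma values. This turns the moments of the Beta
  kernel into hypergeometric coefficients.\<close>

lemma Beta_plus_of_nat: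
  fixes b d :: complex
  assumes "Re b > 0" "Re d > 0"
  shows "Beta (b + of_nat n) d = pochhammer b n / pochhammer (b + d) n * Beta b d"
proof -
  have "b \<notin> \<int>\<^sub>\<le>\<^sub>0" "b + d \<notin> \<int>\<^sub>\<le>\<^sub>0" using assms by (auto intro!: not_nonpos_Ints_if_Re_pos)
  then show ?thesis
    by (simp add: Beta_def pochhammer_Gamma Gamma_eq_zero_iff add_ac)
qed

text \<open>The binomial series converges at a real \<open>r\<close> with
  \<open>norm z < r < 1\<close>, hence absolutely at \<open>z\<close>.\<close>

lemma summable_norm_gbinomial:
  fixes z a :: complex
  assumes "norm z < 1"
  shows "summable (\<lambda>n. norm ((a gchoose n) * z ^ n))"
proof -
  obtain r where r: "norm z < r" "r < 1" using assms dense by blast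
  have r0: "r > 0" using r(1) norm_ge_zero[of z] by linarith
  have "summable (\<lambda>n. (a gchoose n) * of_real r ^ n)"
    using gen_binomial_complex[of "of_real r" a] r0 r by (simp add: sums_iff)
  then show ?thesis by (rule powser_insidea) (use r r0 in auto)
qed

text \<open>Expand \<open>(1 - t z) powr (- a)\<close> by the binomial series and integrate term by
  term; the n-th term is a multiple of \<open>Beta (b + n) (c - b)\<close>.\<close>

lemma euler_integral_sums:
  fixes a b c z :: complex
  assumes bc: "Re b > 0" "Re c > Re b" and z: "norm z < 1"
  shows "(\<lambda>n. fps_nth (fps_hypergeo [a, b] [c] 1) n * z ^ n * Beta b (c - b)) sums
     (LINT t:{0<..<1}|lborel. of_real t powr (b - 1) * of_real (1 - t) powr (c - b - 1)
                 * (1 - of_real t * z) powr (- a))"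
proof -
  define k where "k = (\<lambda>t. indicator {0<..<1} t *\<^sub>R
      (of_real t powr (b - 1) * of_real (1 - t) powr (c - b - 1) :: complex))"
  define \<alpha> where "\<alpha> = (\<lambda>n. ((- a) gchoose n) * (- z) ^ n)"
  define f where "f = (\<lambda>n t. k t * (\<alpha> n * of_real t ^ n))"
  \<comment> \<open>The factor \<open>t ^ n\<close> is absorbed into the kernel, which raises the
    parameter \<open>b\<close> to \<open>b + n\<close>.\<close>
  have f_eq: "f n t = \<alpha> n * (indicator {0<..<1} t *\<^sub>R
      (of_real t powr (b + of_nat n - 1) * of_real (1 - t) powr (c - b - 1)))" for n t
  proof (cases "t \<in> {0<..<1}")
    case True
    then have "complex_of_real t powr ((b - 1) + of_nat n) = of_real t powr (b - 1) * of_real t ^ n"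
      by (simp only: powr_add) simp
    moreover have "b + of_nat n - 1 = (b - 1) + of_nat n" by simp
    ultimately show ?thesis by (simp only: f_def k_def) (simp del: of_real_diff)
  qed (simp add: f_def k_def)
  have Re_n: "Re (b + of_nat n) > 0" "Re (c - b) > 0" for n using bc by (auto simp: add_pos_nonneg)
  have k: "integrable lborel k"
    using set_integrable_beta_kernel[of b "c - b"] bc by (simp add: set_integrable_def k_def)
  have f_int: "integrable lborel (f n)" for n
    using set_integrable_beta_kernel[OF Re_n, of n]
    unfolding f_eq set_integrable_def by (intro integrable_mult_right)
  \<comment> \<open>Because \<open>t ^ n \<le> 1\<close>, the bound separates into an integrable
    function of \<open>t\<close> and a summable sequence, which justifies exchanging sum and
    integral.\<close>
  have f_norm: "norm (f n t) \<le> norm (k t) * norm (\<alpha> n)" for n t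
  proof (cases "t \<in> {0<..<1}")
    case True
    then have "norm (\<alpha> n * of_real t ^ n) \<le> norm (\<alpha> n) * 1"
      unfolding norm_mult by (intro mult_left_mono) (auto simp: norm_power power_le_one)
    then show ?thesis unfolding f_def norm_mult[of "k t"] by (intro mult_left_mono) auto
  qed (simp add: f_def k_def)
  have \<alpha>_sum: "summable (\<lambda>n. norm (\<alpha> n))"
    unfolding \<alpha>_def using z by (intro summable_norm_gbinomial) simp
  have "(\<lambda>n. LINT t|lborel. f n t) sums (LINT t|lborel. (\<Sum>n. f n t))"
  proof (rule sums_integral[OF f_int])
    show "AE t in lborel. summable (\<lambda>n. norm (f n t))"
    proof (rule AE_I2)
      fix t
      show "summable (\<lambda>n. norm (f n t))"
        by (rule summable_comparison_test'[OF summable_mult[OF \<alpha>_sum, of "norm (k t)"]])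
           (simp add: f_norm)
    qed
    show "summable (\<lambda>n. LINT t|lborel. norm (f n t))"
    proof (rule summable_comparison_test'[OF summable_mult[OF \<alpha>_sum]])
      fix n :: nat
      have "(LINT t|lborel. norm (f n t)) \<le> (LINT t|lborel. norm (k t) * norm (\<alpha> n))"
        using f_int k by (intro integral_mono f_norm) auto
      then show "norm (LINT t|lborel. norm (f n t)) \<le> (LINT t|lborel. norm (k t)) * norm (\<alpha> n)"
        by simp
    qed
  qed
  also have "(\<lambda>n. LINT t|lborel. f n t) = (\<lambda>n. fps_nth (fps_hypergeo [a, b] [c] 1) n * z ^ n * Beta b (c - b))"
  proof
    fix n
    have "(LINT t|lborel. f n t) = \<alpha> n * Beta (b + of_nat n) (c - b)"
      unfolding f_eq integral_mult_right_zero using beta_integral_complex[OF Re_n, of n]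
      by (simp only: set_lebesgue_integral_def)
    also have "\<dots> = \<alpha> n * (pochhammer b n / pochhammer c n * Beta b (c - b))"
      using Beta_plus_of_nat[of b "c - b" n] bc by simp
    \<comment> \<open>One sign comes from the binomial coefficient with upper entry
      \<open>- a\<close>, the other from the power of \<open>- z\<close>; they cancel.\<close>
    also have "\<alpha> n = (- 1) ^ n * (- 1) ^ n * (pochhammer a n / fact n * z ^ n)"
      unfolding \<alpha>_def gbinomial_pochhammer power_minus[of z] by simp
    also have "(- 1) ^ n * (- 1) ^ n = (1 :: complex)"
      by (simp flip: power_mult_distrib)
    finally show "(LINT t|lborel. f n t) = fps_nth (fps_hypergeo [a, b] [c] 1) n * z ^ n * Beta b (c - b)"
      by (simp add: algebra_simps)
  qed
  also have "(LINT t|lborel. (\<Sum>n. f n t)) =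
     (LINT t:{0<..<1}|lborel. of_real t powr (b - 1) * of_real (1 - t) powr (c - b - 1)
                 * (1 - of_real t * z) powr (- a))"
    unfolding set_lebesgue_integral_def
  proof (rule Bochner_Integration.integral_cong[OF refl])
    fix t :: real
    show "(\<Sum>n. f n t) = indicator {0<..<1} t *\<^sub>R (of_real t powr (b - 1) * of_real (1 - t) powr (c - b - 1)
                 * (1 - of_real t * z) powr (- a))"
    proof (cases "t \<in> {0<..<1}")
      case True
      then have "norm (- (of_real t * z)) < 1"
        using z mult_strict_mono[of t 1 "norm z" 1] by (auto simp: norm_mult)
      from sums_mult[OF gen_binomial_complex[OF this, of "- a"], of "k t"]
      have "(\<lambda>n. k t * ((- a gchoose n) * (- (of_real t * z)) ^ n)) sums
              (k t * (1 - of_real t * z) powr (- a))" by simp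
      moreover have "k t * ((- a gchoose n) * (- (of_real t * z)) ^ n) = f n t" for n
        unfolding mult_minus_right[symmetric] power_mult_distrib by (simp add: f_def \<alpha>_def)
      ultimately have "(\<lambda>n. f n t) sums (k t * (1 - of_real t * z) powr (- a))" by simp
      with True show ?thesis by (simp add: sums_iff k_def del: of_real_diff)
    qed (simp add: f_def k_def)
  qed
  finally show ?thesis .
qed

text \<open>The integral is holomorphic on the slit plane, and on the disc the Gamma quotient is the
  reciprocal of \<open>Beta b (c - b)\<close>, which cancels the Beta factor of the series.\<close>

theorem is_hyp2F1_euler_integral:
  fixes a b c :: complex
  assumes bc: "Re b > 0" "Re c > Re b"
  shows "is_hyp2F1 a b c (\<lambda>z. Gamma c / (Gamma b * Gamma (c - b)) *
     (LINT t:{0<..<1}|lborel. of_real t powr (b - 1) * of_real (1 - t) powr (c - b - 1)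
                 * (1 - of_real t * z) powr (- a)))"
  unfolding is_hyp2F1_def
proof (intro conjI ballI)
  fix z :: complex assume "z \<in> ball 0 1"
  then have z: "norm z < 1" by simp
  have "Gamma b \<noteq> 0" "Gamma (c - b) \<noteq> 0" "Gamma c \<noteq> 0"
    using bc not_nonpos_Ints_if_Re_pos[of b] not_nonpos_Ints_if_Re_pos[of c]
      not_nonpos_Ints_if_Re_pos[of "c - b"] by (auto simp: Gamma_eq_zero_iff)
  then have B: "Gamma c / (Gamma b * Gamma (c - b)) * (u * Beta b (c - b)) = u" for u
    by (simp add: Beta_def)
  from sums_mult[OF euler_integral_sums[OF bc z, of a], of "Gamma c / (Gamma b * Gamma (c - b))"]
  show "Gamma c / (Gamma b * Gamma (c - b)) * (LINT t:{0<..<1}|lborel. of_real t powr (b - 1) * of_real (1 - t) powr (c - b - 1)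
                 * (1 - of_real t * z) powr (- a)) = eval_fps (fps_hypergeo [a, b] [c] 1) z"
    unfolding B eval_fps_def by (simp only: sums_iff)
qed (intro holomorphic_intros holomorphic_euler_integral bc)

text \<open>The integral also witnesses that a continuation exists, so the function chosen by
  \<open>SOME\<close> is one; uniqueness on the slit plane identifies the two.\<close>

corollary hyp2F1_euler_integral:
  fixes a b c :: complex
  assumes bc: "Re b > 0" "Re c > Re b" and z: "z \<in> slit_plane"
  shows "hyp2F1 a b c z = Gamma c / (Gamma b * Gamma (c - b)) *
     (LINT t:{0<..<1}|lborel. of_real t powr (b - 1) * of_real (1 - t) powr (c - b - 1)
                 * (1 - of_real t * z) powr (- a))"
proof -
  have "is_hyp2F1 a b c (hyp2F1 a b c)"
    unfolding hyp2F1_def by (rule someI[of "is_hyp2F1 a b c", OF is_hyp2F1_euler_integral[OF bc]])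
  from is_hyp2F1_unique[OF this is_hyp2F1_euler_integral[OF bc] z] show ?thesis .
qed

text \<open>The series is symmetric in \<open>a\<close> and \<open>b\<close>, so both choices are
  made from the same predicate and agree even on the cut. Euler's integral treats the two parameters
  differently, which is why the order matters below.\<close>

lemma hyp2F1_commute: "hyp2F1 a b c = hyp2F1 b a c"
proof -
  have "fps_hypergeo [a, b] [c] 1 = fps_hypergeo [b, a] [c] (1::complex)"
    by (rule fps_ext) (simp add: mult.commute)
  then show ?thesis by (simp add: hyp2F1_def is_hyp2F1_def)
qed

subsection \<open>Moebius substitutions\<close>

text \<open>Positive bases turn every power into an exponential of a real logarithm, so that
  identities between products of powers become linear identities between exponents.\<close>

lemma of_real_powr_eq_exp:
  "x > 0 \<Longrightarrow> ln x = l \<Longrightarrow> of_real x powr p = exp (p * of_real l)" for p :: complex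
  by (auto simp: powr_def Ln_of_real)

lemma of_real_eq_exp: "x > 0 \<Longrightarrow> ln x = l \<Longrightarrow> of_real x = exp (complex_of_real l)"
  by (auto simp: exp_of_real)

lemma one_minus_mult_pos: "0 < t \<Longrightarrow> t < 1 \<Longrightarrow> z < 1 \<Longrightarrow> 0 < 1 - t * z" for t z :: real
proof -
  assume "0 < t" "t < 1" "z < 1"
  then have "0 < t * (1 - z)" by simp
  with \<open>t < 1\<close> show "0 < 1 - t * z" by (simp add: right_diff_distrib)
qed

lemma of_real_in_slit_plane: "x < 1 \<Longrightarrow> of_real x \<in> slit_plane"
  by (auto simp: slit_plane_def)

text \<open>Common frame of the six cases: \<open>g\<close>, with inverse \<open>h\<close>, maps the
  unit interval onto \<open>S\<close> and pulls \<open>f\<close> back to \<kappa> times an Euler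
  integrand at \<open>z\<close>. The power \<mu> is the part of the constant \<open>k\<close>
  outside the Gamma quotient. A separate \<open>D\<close> for \<open>C - B\<close> lets each case
  state it in simplified form.\<close>

lemma has_integral_rep_substitution:
  fixes A B C D k \<kappa> \<mu> :: complex and z :: real and f :: "real \<Rightarrow> complex"
  assumes B: "Re B > 0" and D: "Re D > 0" and C: "C = B + D" and z: "z < 1"
    and S: "S \<in> sets borel"
    and gS: "\<And>t. 0 < t \<Longrightarrow> t < 1 \<Longrightarrow> g t \<in> S \<and> h (g t) = t"
    and hS: "\<And>y. y \<in> S \<Longrightarrow> 0 < h y \<and> h y < 1 \<and> g (h y) = y"
    and der: "\<And>t. 0 < t \<Longrightarrow> t < 1 \<Longrightarrow> (g has_field_derivative g' t) (at t)"
    and cont: "continuous_on S f"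
    and pull: "\<And>t. 0 < t \<Longrightarrow> t < 1 \<Longrightarrow> of_real \<bar>g' t\<bar> * f (g t) =
        \<kappa> * (of_real t powr (B - 1) * of_real (1 - t) powr (D - 1) * of_real (1 - t * z) powr (- A))"
    and k: "k = Gamma C / (Gamma B * Gamma D) * \<mu>"
    and w: "w = \<mu> * \<kappa> * hyp2F1 A B C (of_real z)"
  shows "has_integral_rep w k S f"
proof -
  have CD: "C - B = D" "Re C > Re B" using C D by auto
  have img: "g ` {0<..<1} = S"
    using gS hS by (force simp: image_iff)
  have inj: "inj_on g {0<..<1}"
    using gS by (intro inj_on_inverseI[of _ h]) auto
  define E where "E = (\<lambda>t. of_real t powr (B - 1) * of_real (1 - t) powr (D - 1) *
      (1 - of_real t * of_real z) powr (- A))"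
  have pull': "of_real \<bar>g' t\<bar> * f (g t) = \<kappa> * E t" if "t \<in> {0<..<1}" for t
    using pull[of t] that by (simp add: E_def)
  have E: "set_integrable lborel {0<..<1} E"
    using set_integrable_euler_integrand[OF B CD(2) of_real_in_slit_plane[OF z]] by (simp only: E_def CD)
  then have int: "set_integrable lborel {0<..<1} (\<lambda>t. of_real \<bar>g' t\<bar> * f (g t))"
    using pull' by (subst set_integrable_cong[OF refl refl pull']) auto
  have "(LINT t:{0<..<1}|lborel. of_real \<bar>g' t\<bar> * f (g t)) = (LINT t:{0<..<1}|lborel. \<kappa> * E t)"
    using pull' by (intro set_lebesgue_integral_cong) auto
  moreover have "hyp2F1 A B C (of_real z) = Gamma C / (Gamma B * Gamma D) * (LINT t:{0<..<1}|lborel. E t)"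
    using hyp2F1_euler_integral[OF B CD(2) of_real_in_slit_plane[OF z]] by (simp only: E_def CD)
  moreover note set_integral_change_of_variables_complex[of "{0<..<1}" g g' f, unfolded img, OF _ S der inj cont int]
  ultimately show ?thesis
    by (simp add: has_integral_rep_def k w)
qed

section \<open>The six integral representations\<close>

text \<open>With \<open>y = x * t\<close> the Jacobian, \<open>\<bar>y\<bar>\<close> and
  \<open>\<bar>x - y\<bar>\<close> contribute \<open>\<bar>x\<bar>\<close> to the power
  \<open>1 + (b - 1) + (c - b - 1) = c - 1\<close>, which the prefactor cancels.\<close>

lemma hypergeo_integral_rep_w1:
  assumes x: "x < 1" "x \<noteq> 0" and re: "Re c > Re b" "Re b > 0"
  shows "has_integral_rep (w1 x a b c)
         (Gamma c / (Gamma b * Gamma (c - b)) * of_real \<bar>x\<bar> powr (1 - c))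
         {y. 0 < y / x \<and> y / x < 1}
         (\<lambda>y. of_real \<bar>y\<bar> powr (b - 1) * of_real (1 - y) powr (- a) * of_real \<bar>x - y\<bar> powr (c - b - 1))" (is "has_integral_rep _ _ ?S _")
proof (rule has_integral_rep_substitution[where g = "\<lambda>t. x * t" and g' = "\<lambda>t. x"
      and h = "\<lambda>y. y / x" and A = "a" and B = "b" and D = "c - b" and C = "c" and z = "x"
      and \<kappa> = "of_real \<bar>x\<bar> powr (c - 1)" and \<mu> = "of_real \<bar>x\<bar> powr (1 - c)"])
  have S: "\<bar>y\<bar> > 0 \<and> 1 - y > 0 \<and> \<bar>x - y\<bar> > 0" if "y \<in> ?S" for y
    using that x by (cases "x > 0") (auto simp: field_simps)
  show "continuous_on ?S (\<lambda>y. of_real \<bar>y\<bar> powr (b - 1) * of_real (1 - y) powr (- a) * of_real \<bar>x - y\<bar> powr (c - b - 1))"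
    using S by (intro continuous_on_mult continuous_on_of_real_powr continuous_intros) auto
  show "?S \<in> sets borel"
    by measurable
  show "0 < y / x \<and> y / x < 1 \<and> (\<lambda>t. x * t) (y / x) = y" if "y \<in> ?S" for y
    using that x by auto
  fix t :: real assume t: "0 < t" "t < 1"
  have pos: "\<bar>x\<bar> > 0"
    "1 - t > 0"
    "t > 0"
    "1 - t * x > 0"
    using x t one_minus_mult_pos[OF t, of x] by auto
  show "x * t \<in> ?S \<and> (\<lambda>y. y / x) (x * t) = t"
    using t x by auto
  show "((\<lambda>t. x * t) has_field_derivative x) (at t)"
    by (auto intro!: derivative_eq_intros)
  have "x - x * t = x * (1 - t)" by (simp add: right_diff_distrib)
  then have e: "\<bar>x * t\<bar> = \<bar>x\<bar> * t"
    "\<bar>x - x * t\<bar> = \<bar>x\<bar> * (1 - t)"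
    "1 - x * t = 1 - t * x"
    using t by (simp_all add: abs_mult)
  \<comment> \<open>This is for the Jacobian. It is kept apart from \<open>P\<close> because it
    would also match the base of the powers of \<open>\<bar>x\<bar>\<close>.\<close>
  have X: "of_real \<bar>x\<bar> = exp (complex_of_real (ln \<bar>x\<bar>))"
    using pos by (intro of_real_eq_exp) auto
  have P: "of_real (\<bar>x\<bar> * t) powr p = exp (p * of_real (ln \<bar>x\<bar> + ln t))"
    "of_real (\<bar>x\<bar> * (1 - t)) powr p = exp (p * of_real (ln \<bar>x\<bar> + ln (1 - t)))"
    "of_real (1 - t * x) powr p = exp (p * of_real (ln (1 - t * x)))"
    "of_real \<bar>x\<bar> powr p = exp (p * of_real (ln \<bar>x\<bar>))"
    "of_real t powr p = exp (p * of_real (ln t))"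
    "of_real (1 - t) powr p = exp (p * of_real (ln (1 - t)))" for p :: complex
    by (rule of_real_powr_eq_exp; use pos in \<open>simp add: ln_mult ln_div ln_realpow\<close>)+
  show "of_real \<bar>x\<bar> * (of_real \<bar>(x * t)\<bar> powr (b - 1) * of_real (1 - (x * t)) powr (- a) * of_real \<bar>x - (x * t)\<bar> powr (c - b - 1)) =
        of_real \<bar>x\<bar> powr (c - 1) * (of_real t powr (b - 1) * of_real (1 - t) powr (c - b - 1)
           * of_real (1 - t * x) powr (- a))"
    unfolding e P unfolding X exp_add[symmetric] by (rule arg_cong[where f = exp]) (simp add: algebra_simps)
next
  show "w1 x a b c = of_real \<bar>x\<bar> powr (1 - c) * of_real \<bar>x\<bar> powr (c - 1) * hyp2F1 a b c (of_real x)"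
    using x unfolding w1_def powr_add[symmetric] by simp
qed (use x re in auto)

text \<open>With \<open>y = 1 / t\<close> the powers of \<open>t\<close> add up to
  \<open>-2 - (b - 1) + a - (c - b - 1) = a - c\<close>. So \<open>a - c + 1\<close> is the Beta
  parameter, and the upper parameters appear in swapped order.\<close>

lemma hypergeo_integral_rep_w2:
  assumes x: "x < 1" "x \<noteq> 0" and re: "Re (c - 1) < Re a" "Re a < 1"
  shows "has_integral_rep (w2 x a b c)
         (Gamma (2 - c) / (Gamma (a - c + 1) * Gamma (1 - a)) * of_real \<bar>x\<bar> powr (1 - c))
         {1<..}
         (\<lambda>y. of_real y powr (b - 1) * of_real (y - 1) powr (- a) * of_real (y - x) powr (c - b - 1))" (is "has_integral_rep _ _ ?S _")
proof (rule has_integral_rep_substitution[where g = "\<lambda>t. 1 / t" and g' = "\<lambda>t. - 1 / t\<^sup>2"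
      and h = "\<lambda>y. 1 / y" and A = "b - c + 1" and B = "a - c + 1" and D = "1 - a" and C = "2 - c" and z = "x"
      and \<kappa> = "1" and \<mu> = "of_real \<bar>x\<bar> powr (1 - c)"])
  have S: "y > 0 \<and> y - 1 > 0 \<and> y - x > 0" if "y \<in> ?S" for y
    using that x by auto
  show "continuous_on ?S (\<lambda>y. of_real y powr (b - 1) * of_real (y - 1) powr (- a) * of_real (y - x) powr (c - b - 1))"
    using S by (intro continuous_on_mult continuous_on_of_real_powr continuous_intros) auto
  show "?S \<in> sets borel"
    by simp
  show "0 < 1 / y \<and> 1 / y < 1 \<and> (\<lambda>t. 1 / t) (1 / y) = y" if "y \<in> ?S" for y
    using that by auto
  fix t :: real assume t: "0 < t" "t < 1"
  have pos: "\<bar>x\<bar> > 0"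
    "1 - t > 0"
    "t > 0"
    "1 - t * x > 0"
    using x t one_minus_mult_pos[OF t, of x] by auto
  show "1 / t \<in> ?S \<and> (\<lambda>y. 1 / y) (1 / t) = t"
    using t by auto
  show "((\<lambda>t. 1 / t) has_field_derivative - 1 / t\<^sup>2) (at t)"
    using t by (auto intro!: derivative_eq_intros simp: power2_eq_square)
  \<comment> \<open>Writing the Jacobian as a \<open>powr\<close> brings it within reach of the
    rules \<open>P\<close>.\<close>
  have e: "complex_of_real \<bar>- 1 / t\<^sup>2\<bar> = of_real (1 / t) powr 2"
    "1 / t - 1 = (1 - t) / t"
    "1 / t - x = (1 - t * x) / t"
    using t by (auto simp: field_simps powr_numeral)
  have P: "of_real (1 / t) powr p = exp (p * of_real (- ln t))"
    "of_real ((1 - t) / t) powr p = exp (p * of_real (ln (1 - t) - ln t))"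
    "of_real ((1 - t * x) / t) powr p = exp (p * of_real (ln (1 - t * x) - ln t))"
    "of_real (1 - t * x) powr p = exp (p * of_real (ln (1 - t * x)))"
    "of_real \<bar>x\<bar> powr p = exp (p * of_real (ln \<bar>x\<bar>))"
    "of_real t powr p = exp (p * of_real (ln t))"
    "of_real (1 - t) powr p = exp (p * of_real (ln (1 - t)))" for p :: complex
    by (rule of_real_powr_eq_exp; use pos in \<open>simp add: ln_mult ln_div ln_realpow\<close>)+
  show "of_real \<bar>- 1 / t\<^sup>2\<bar> * (of_real (1 / t) powr (b - 1) * of_real ((1 / t) - 1) powr (- a) * of_real ((1 / t) - x) powr (c - b - 1)) =
        1 * (of_real t powr (a - c + 1 - 1) * of_real (1 - t) powr (1 - a - 1)
           * of_real (1 - t * x) powr (- (b - c + 1)))"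
    unfolding e P exp_add[symmetric] mult_1_left by (rule arg_cong[where f = exp]) (simp add: algebra_simps)
next
  show "w2 x a b c = of_real \<bar>x\<bar> powr (1 - c) * 1 * hyp2F1 (b - c + 1) (a - c + 1) (2 - c) (of_real x)"
    unfolding w2_def hyp2F1_commute[of "b - c + 1"] by simp
qed (use x re in auto)

text \<open>With \<open>y = x / t\<close> one has \<open>y - 1 = x * (1 - t / x) / t\<close>, so the
  argument is \<open>1 / x\<close>. The collected power \<open>c - a - 1\<close> of
  \<open>\<bar>x\<bar>\<close> and the prefactor leave \<open>- a\<close>.\<close>

lemma hypergeo_integral_rep_w3:
  assumes x: "x < 0 \<or> x > 1" and re: "Re (a - c + 1) > 0" "Re (c - b) > 0"
  shows "has_integral_rep (w3 x a b c)
         (Gamma (a - b + 1) / (Gamma (a - c + 1) * Gamma (c - b)) * of_real \<bar>x\<bar> powr (1 - c))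
         {y. y / x > 1}
         (\<lambda>y. of_real \<bar>y\<bar> powr (b - 1) * of_real \<bar>y - 1\<bar> powr (- a) * of_real \<bar>y - x\<bar> powr (c - b - 1))" (is "has_integral_rep _ _ ?S _")
proof (rule has_integral_rep_substitution[where g = "\<lambda>t. x / t" and g' = "\<lambda>t. - x / t\<^sup>2"
      and h = "\<lambda>y. x / y" and A = "a" and B = "a - c + 1" and D = "c - b" and C = "a - b + 1" and z = "inverse x"
      and \<kappa> = "of_real \<bar>x\<bar> powr (c - a - 1)" and \<mu> = "of_real \<bar>x\<bar> powr (1 - c)"])
  \<comment> \<open>Either \<open>1 < x < y\<close> or \<open>y < x < 0\<close>, so no base
    vanishes.\<close>
  have S: "\<bar>y\<bar> > 0 \<and> \<bar>y - 1\<bar> > 0 \<and> \<bar>y - x\<bar> > 0" if "y \<in> ?S" for y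
    using that x by (auto simp: field_simps)
  show "continuous_on ?S (\<lambda>y. of_real \<bar>y\<bar> powr (b - 1) * of_real \<bar>y - 1\<bar> powr (- a) * of_real \<bar>y - x\<bar> powr (c - b - 1))"
    using S by (intro continuous_on_mult continuous_on_of_real_powr continuous_intros) auto
  show "?S \<in> sets borel"
    by measurable
  show "0 < x / y \<and> x / y < 1 \<and> (\<lambda>t. x / t) (x / y) = y" if "y \<in> ?S" for y
    using that x by (auto simp: field_simps)
  fix t :: real assume t: "0 < t" "t < 1"
  have pos: "\<bar>x\<bar> > 0"
    "1 - t > 0"
    "t > 0"
    "1 - t * inverse x > 0"
    using x t one_minus_mult_pos[OF t, of "inverse x"] by (auto simp: inverse_less_1_iff)
  show "x / t \<in> ?S \<and> (\<lambda>y. x / y) (x / t) = t"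
    using t x by auto
  show "((\<lambda>t. x / t) has_field_derivative - x / t\<^sup>2) (at t)"
    using t by (auto intro!: derivative_eq_intros simp: power2_eq_square)
  have "x / t - 1 = x * (1 - t * inverse x) / t" "x / t - x = x * (1 - t) / t"
    using t x by (auto simp: field_simps)
  then have e: "complex_of_real \<bar>- x / t\<^sup>2\<bar> = of_real (\<bar>x\<bar> / t\<^sup>2) powr 1"
    "\<bar>x / t\<bar> = \<bar>x\<bar> / t"
    "\<bar>x / t - 1\<bar> = \<bar>x\<bar> * (1 - t * inverse x) / t"
    "\<bar>x / t - x\<bar> = \<bar>x\<bar> * (1 - t) / t"
    using pos by (simp_all add: abs_mult)
  have P: "of_real (\<bar>x\<bar> / t\<^sup>2) powr p = exp (p * of_real (ln \<bar>x\<bar> - 2 * ln t))"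
    "of_real (\<bar>x\<bar> / t) powr p = exp (p * of_real (ln \<bar>x\<bar> - ln t))"
    "of_real (\<bar>x\<bar> * (1 - t * inverse x) / t) powr p = exp (p * of_real (ln \<bar>x\<bar> + ln (1 - t * inverse x) - ln t))"
    "of_real (\<bar>x\<bar> * (1 - t) / t) powr p = exp (p * of_real (ln \<bar>x\<bar> + ln (1 - t) - ln t))"
    "of_real (1 - t * inverse x) powr p = exp (p * of_real (ln (1 - t * inverse x)))"
    "of_real \<bar>x\<bar> powr p = exp (p * of_real (ln \<bar>x\<bar>))"
    "of_real t powr p = exp (p * of_real (ln t))"
    "of_real (1 - t) powr p = exp (p * of_real (ln (1 - t)))" for p :: complex
    by (rule of_real_powr_eq_exp; use pos in \<open>simp add: ln_mult ln_div ln_realpow\<close>)+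
  show "of_real \<bar>- x / t\<^sup>2\<bar> * (of_real \<bar>(x / t)\<bar> powr (b - 1) * of_real \<bar>(x / t) - 1\<bar> powr (- a) * of_real \<bar>(x / t) - x\<bar> powr (c - b - 1)) =
        of_real \<bar>x\<bar> powr (c - a - 1) * (of_real t powr (a - c + 1 - 1) * of_real (1 - t) powr (c - b - 1)
           * of_real (1 - t * (inverse x)) powr (- a))"
    unfolding e P exp_add[symmetric] by (rule arg_cong[where f = exp]) (simp add: algebra_simps)
next
  show "w3 x a b c = of_real \<bar>x\<bar> powr (1 - c) * of_real \<bar>x\<bar> powr (c - a - 1) *
      hyp2F1 a (a - c + 1) (a - b + 1) (of_real (inverse x))"
    unfolding w3_def powr_add[symmetric] by simp
qed (use x re in \<open>auto simp: inverse_less_1_iff\<close>)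

text \<open>Only \<open>\<bar>x - y\<bar> = \<bar>x\<bar> * (1 - y / x)\<close> has to be rewritten.
  The Beta parameters are \<open>b\<close> and \<open>1 - a\<close>, whence the Gamma factors and
  the conditions on \<open>a\<close> and \<open>b\<close>.\<close>

lemma hypergeo_integral_rep_w4:
  assumes x: "x < 0 \<or> x > 1" and re: "Re a < 1" "Re b > 0"
  shows "has_integral_rep (w4 x a b c)
         (Gamma (b - a + 1) / (Gamma (1 - a) * Gamma b) * of_real \<bar>x\<bar> powr (1 - c))
         {0<..<1}
         (\<lambda>y. of_real y powr (b - 1) * of_real (1 - y) powr (- a) * of_real \<bar>x - y\<bar> powr (c - b - 1))" (is "has_integral_rep _ _ ?S _")
proof (rule has_integral_rep_substitution[where g = "\<lambda>t. t" and g' = "\<lambda>t. 1"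
      and h = "\<lambda>y. y" and A = "b - c + 1" and B = "b" and D = "1 - a" and C = "b - a + 1" and z = "inverse x"
      and \<kappa> = "of_real \<bar>x\<bar> powr (c - b - 1)" and \<mu> = "of_real \<bar>x\<bar> powr (1 - c)"])
  have S: "y > 0 \<and> 1 - y > 0 \<and> \<bar>x - y\<bar> > 0" if "y \<in> ?S" for y
    using that x by auto
  show "continuous_on ?S (\<lambda>y. of_real y powr (b - 1) * of_real (1 - y) powr (- a) * of_real \<bar>x - y\<bar> powr (c - b - 1))"
    using S by (intro continuous_on_mult continuous_on_of_real_powr continuous_intros) auto
  show "?S \<in> sets borel"
    by simp
  show "0 < y \<and> y < 1 \<and> (\<lambda>t. t) (y) = y" if "y \<in> ?S" for y
    using that by auto
  fix t :: real assume t: "0 < t" "t < 1"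
  have pos: "\<bar>x\<bar> > 0"
    "1 - t > 0"
    "t > 0"
    "1 - t * inverse x > 0"
    using x t one_minus_mult_pos[OF t, of "inverse x"] by (auto simp: inverse_less_1_iff)
  show "t \<in> ?S \<and> (\<lambda>y. y) (t) = t"
    using t by auto
  show "((\<lambda>t. t) has_field_derivative 1) (at t)"
    by (auto intro!: derivative_eq_intros)
  have "x - t = x * (1 - t * inverse x)"
    using x by (auto simp: field_simps)
  \<comment> \<open>The trivial Jacobian is written as an exponential so that it merges with the
    other factors.\<close>
  then have e: "complex_of_real \<bar>1\<bar> = exp 0"
    "\<bar>x - t\<bar> = \<bar>x\<bar> * (1 - t * inverse x)"
    using pos by (simp_all add: abs_mult)
  have P: "of_real (\<bar>x\<bar> * (1 - t * inverse x)) powr p = exp (p * of_real (ln \<bar>x\<bar> + ln (1 - t * inverse x)))"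
    "of_real (1 - t * inverse x) powr p = exp (p * of_real (ln (1 - t * inverse x)))"
    "of_real \<bar>x\<bar> powr p = exp (p * of_real (ln \<bar>x\<bar>))"
    "of_real t powr p = exp (p * of_real (ln t))"
    "of_real (1 - t) powr p = exp (p * of_real (ln (1 - t)))" for p :: complex
    by (rule of_real_powr_eq_exp; use pos in \<open>simp add: ln_mult ln_div ln_realpow\<close>)+
  show "of_real \<bar>1\<bar> * (of_real t powr (b - 1) * of_real (1 - (t)) powr (- a) * of_real \<bar>x - (t)\<bar> powr (c - b - 1)) =
        of_real \<bar>x\<bar> powr (c - b - 1) * (of_real t powr (b - 1) * of_real (1 - t) powr (1 - a - 1)
           * of_real (1 - t * (inverse x)) powr (- (b - c + 1)))"
    unfolding e P exp_add[symmetric] by (rule arg_cong[where f = exp]) (simp add: algebra_simps)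
next
  show "w4 x a b c = of_real \<bar>x\<bar> powr (1 - c) * of_real \<bar>x\<bar> powr (c - b - 1) *
      hyp2F1 (b - c + 1) b (b - a + 1) (of_real (inverse x))"
    unfolding w4_def powr_add[symmetric] hyp2F1_commute[of "b - c + 1" b] by simp
qed (use x re in \<open>auto simp: inverse_less_1_iff\<close>)

text \<open>With \<open>y = - x * t / (1 - t)\<close> one has \<open>x - y = x / (1 - t)\<close> and
  \<open>1 - y = (1 - t * (1 - x)) / (1 - t)\<close>. The powers of \<open>1 - t\<close> add up to
  \<open>a - c\<close>, those of \<open>x\<close> to \<open>c - 1\<close>.\<close>

lemma hypergeo_integral_rep_w5:
  assumes x: "x > 0" and re: "Re b > 0" "Re (a - c + 1) > 0"
  shows "has_integral_rep (w5 x a b c)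
         (Gamma (a + b - c + 1) / (Gamma (a - c + 1) * Gamma b) * of_real x powr (1 - c))
         {..<0}
         (\<lambda>y. of_real (- y) powr (b - 1) * of_real (1 - y) powr (- a) * of_real (x - y) powr (c - b - 1))" (is "has_integral_rep _ _ ?S _")
proof (rule has_integral_rep_substitution[where g = "\<lambda>t. - (x * t / (1 - t))" and g' = "\<lambda>t. - (x / (1 - t)\<^sup>2)"
      and h = "\<lambda>y. - y / (x - y)" and A = "a" and B = "b" and D = "a - c + 1" and C = "a + b - c + 1" and z = "1 - x"
      and \<kappa> = "of_real x powr (c - 1)" and \<mu> = "of_real x powr (1 - c)"])
  have S: "- y > 0 \<and> 1 - y > 0 \<and> x - y > 0" if "y \<in> ?S" for y
    using that x by auto
  show "continuous_on ?S (\<lambda>y. of_real (- y) powr (b - 1) * of_real (1 - y) powr (- a) * of_real (x - y) powr (c - b - 1))"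
    using S by (intro continuous_on_mult continuous_on_of_real_powr continuous_intros) auto
  show "?S \<in> sets borel"
    by simp
  show "0 < - y / (x - y) \<and> - y / (x - y) < 1 \<and> (\<lambda>t. - (x * t / (1 - t))) (- y / (x - y)) = y" if "y \<in> ?S" for y
    using that x by (auto simp: field_simps)
  fix t :: real assume t: "0 < t" "t < 1"
  have pos: "x > 0"
    "1 - t > 0"
    "t > 0"
    "1 - t * (1 - x) > 0"
    using x t one_minus_mult_pos[OF t, of "1 - x"] by auto
  show "- (x * t / (1 - t)) \<in> ?S \<and> (\<lambda>y. - y / (x - y)) (- (x * t / (1 - t))) = t"
    using t x by (auto simp: field_simps)
  show "((\<lambda>t. - (x * t / (1 - t))) has_field_derivative - (x / (1 - t)\<^sup>2)) (at t)"
    using t by (auto intro!: derivative_eq_intros simp: power2_eq_square field_simps)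
  have e: "complex_of_real \<bar>- (x / (1 - t)\<^sup>2)\<bar> = of_real (x / (1 - t)\<^sup>2) powr 1"
    "- (- (x * t / (1 - t))) = x * t / (1 - t)"
    "1 - - (x * t / (1 - t)) = (1 - t * (1 - x)) / (1 - t)"
    "x - - (x * t / (1 - t)) = x / (1 - t)"
    using t x by (auto simp: field_simps)
  have P: "of_real (x / (1 - t)\<^sup>2) powr p = exp (p * of_real (ln x - 2 * ln (1 - t)))"
    "of_real (x * t / (1 - t)) powr p = exp (p * of_real (ln x + ln t - ln (1 - t)))"
    "of_real ((1 - t * (1 - x)) / (1 - t)) powr p = exp (p * of_real (ln (1 - t * (1 - x)) - ln (1 - t)))"
    "of_real (x / (1 - t)) powr p = exp (p * of_real (ln x - ln (1 - t)))"
    "of_real (1 - t * (1 - x)) powr p = exp (p * of_real (ln (1 - t * (1 - x))))"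
    "of_real x powr p = exp (p * of_real (ln x))"
    "of_real t powr p = exp (p * of_real (ln t))"
    "of_real (1 - t) powr p = exp (p * of_real (ln (1 - t)))" for p :: complex
    by (rule of_real_powr_eq_exp; use pos in \<open>simp add: ln_mult ln_div ln_realpow\<close>)+
  show "of_real \<bar>- (x / (1 - t)\<^sup>2)\<bar> * (of_real (- (- (x * t / (1 - t)))) powr (b - 1) * of_real (1 - (- (x * t / (1 - t)))) powr (- a) * of_real (x - (- (x * t / (1 - t)))) powr (c - b - 1)) =
        of_real x powr (c - 1) * (of_real t powr (b - 1) * of_real (1 - t) powr (a - c + 1 - 1)
           * of_real (1 - t * (1 - x)) powr (- a))"
    unfolding e P exp_add[symmetric] by (rule arg_cong[where f = exp]) (simp add: algebra_simps)
next
  show "w5 x a b c = of_real x powr (1 - c) * of_real x powr (c - 1) *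
      hyp2F1 a b (a + b - c + 1) (of_real (1 - x))"
    using x unfolding w5_def powr_add[symmetric] by simp
qed (use x re in auto)

text \<open>The map \<open>y = x / q\<close> with \<open>q = 1 - t * (1 - x)\<close> sends 0 to
  \<open>x\<close> and 1 to 1. The powers of \<open>q\<close> add up to \<open>a - c\<close>, which
  gives the parameter \<open>c - a\<close>; those of \<open>\<bar>1 - x\<bar>\<close> add up to
  \<open>c - a - b\<close>, the exponent in \<open>w6\<close>.\<close>

lemma hypergeo_integral_rep_w6:
  assumes x: "x > 0" "x \<noteq> 1" and re: "Re (c - b) > 0" "Re a < 1"
  shows "has_integral_rep (w6 x a b c)
         (Gamma (c - a - b + 1) / (Gamma (1 - a) * Gamma (c - b)) * of_real x powr (1 - c))
         {y. 0 < (1 - y) / (1 - x) \<and> (1 - y) / (1 - x) < 1}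
         (\<lambda>y. of_real y powr (b - 1) * of_real \<bar>1 - y\<bar> powr (- a) * of_real \<bar>x - y\<bar> powr (c - b - 1))" (is "has_integral_rep _ _ ?S _")
proof (rule has_integral_rep_substitution[where g = "\<lambda>t. x / (1 - t * (1 - x))" and g' = "\<lambda>t. x * (1 - x) / (1 - t * (1 - x))\<^sup>2"
      and h = "\<lambda>y. (y - x) / (y * (1 - x))" and A = "c - a" and B = "c - b" and D = "1 - a" and C = "c - a - b + 1" and z = "1 - x"
      and \<kappa> = "of_real x powr (c - 1) * of_real \<bar>1 - x\<bar> powr (c - a - b)" and \<mu> = "of_real x powr (1 - c)"])
  \<comment> \<open>The set is the open interval between \<open>x\<close> and 1, in whichever order
    they lie.\<close>
  have S: "y > 0 \<and> \<bar>1 - y\<bar> > 0 \<and> \<bar>x - y\<bar> > 0" if "y \<in> ?S" for y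
    using that x by (cases "x < 1") (auto simp: field_simps)
  show "continuous_on ?S (\<lambda>y. of_real y powr (b - 1) * of_real \<bar>1 - y\<bar> powr (- a) * of_real \<bar>x - y\<bar> powr (c - b - 1))"
    using S by (intro continuous_on_mult continuous_on_of_real_powr continuous_intros) auto
  show "?S \<in> sets borel"
    by measurable
  show "0 < (y - x) / (y * (1 - x)) \<and> (y - x) / (y * (1 - x)) < 1 \<and> (\<lambda>t. x / (1 - t * (1 - x))) ((y - x) / (y * (1 - x))) = y" if "y \<in> ?S" for y
    using that x S[OF that] by (cases "x < 1") (auto simp: field_simps)
  fix t :: real assume t: "0 < t" "t < 1"
  have pos: "x > 0"
    "\<bar>1 - x\<bar> > 0"
    "1 - t > 0"
    "t > 0"
    "(1 - t * (1 - x)) > 0"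
    using x t one_minus_mult_pos[OF t, of "1 - x"] by auto
  have f: "1 - x / (1 - t * (1 - x)) = (1 - x) * (1 - t) / (1 - t * (1 - x))"
    "x - x / (1 - t * (1 - x)) = - (x * (1 - x) * t / (1 - t * (1 - x)))"
    using pos(5) by (simp_all add: field_simps)
  \<comment> \<open>By \<open>f(1)\<close> this quotient is \<open>(1 - y) / (1 - x)\<close> at the
    image point.\<close>
  have "(1 - t) / (1 - t * (1 - x)) < 1"
    using pos by (simp add: divide_less_eq right_diff_distrib)
  moreover have "(x / (1 - t * (1 - x)) - x) / (x / (1 - t * (1 - x)) * (1 - x)) = t"
    using x pos f(2) by (simp add: minus_diff_eq[of x, symmetric] del: minus_diff_eq)
  ultimately show "x / (1 - t * (1 - x)) \<in> ?S \<and>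
      (\<lambda>y. (y - x) / (y * (1 - x))) (x / (1 - t * (1 - x))) = t"
    using x pos f(1) by simp
  show "((\<lambda>t. x / (1 - t * (1 - x))) has_field_derivative x * (1 - x) / (1 - t * (1 - x))\<^sup>2) (at t)"
    using pos(5) by - ((rule derivative_eq_intros refl | simp add: power2_eq_square)+,
      simp only: minus_divide_left mult_minus_right[symmetric] minus_diff_eq)
  from f have e: "complex_of_real \<bar>x * (1 - x) / (1 - t * (1 - x))\<^sup>2\<bar> = of_real (x * \<bar>1 - x\<bar> / (1 - t * (1 - x))\<^sup>2) powr 1"
    "\<bar>1 - x / (1 - t * (1 - x))\<bar> = \<bar>1 - x\<bar> * (1 - t) / (1 - t * (1 - x))"
    "\<bar>x - x / (1 - t * (1 - x))\<bar> = x * \<bar>1 - x\<bar> * t / (1 - t * (1 - x))"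
    using pos by (simp_all add: abs_mult)
  have P: "of_real (x * \<bar>1 - x\<bar> / (1 - t * (1 - x))\<^sup>2) powr p = exp (p * of_real (ln x + ln \<bar>1 - x\<bar> - 2 * ln (1 - t * (1 - x))))"
    "of_real (\<bar>1 - x\<bar> * (1 - t) / (1 - t * (1 - x))) powr p = exp (p * of_real (ln \<bar>1 - x\<bar> + ln (1 - t) - ln (1 - t * (1 - x))))"
    "of_real (x * \<bar>1 - x\<bar> * t / (1 - t * (1 - x))) powr p = exp (p * of_real (ln x + ln \<bar>1 - x\<bar> + ln t - ln (1 - t * (1 - x))))"
    "of_real (x / (1 - t * (1 - x))) powr p = exp (p * of_real (ln x - ln (1 - t * (1 - x))))"
    "of_real (1 - t * (1 - x)) powr p = exp (p * of_real (ln (1 - t * (1 - x))))"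
    "of_real \<bar>1 - x\<bar> powr p = exp (p * of_real (ln \<bar>1 - x\<bar>))"
    "of_real x powr p = exp (p * of_real (ln x))"
    "of_real t powr p = exp (p * of_real (ln t))"
    "of_real (1 - t) powr p = exp (p * of_real (ln (1 - t)))" for p :: complex
    by (rule of_real_powr_eq_exp; use pos in \<open>simp add: ln_mult ln_div ln_realpow\<close>)+
  show "of_real \<bar>x * (1 - x) / (1 - t * (1 - x))\<^sup>2\<bar> * (of_real (x / (1 - t * (1 - x))) powr (b - 1) * of_real \<bar>1 - (x / (1 - t * (1 - x)))\<bar> powr (- a) * of_real \<bar>x - (x / (1 - t * (1 - x)))\<bar> powr (c - b - 1)) =
        of_real x powr (c - 1) * of_real \<bar>1 - x\<bar> powr (c - a - b) * (of_real t powr (c - b - 1) * of_real (1 - t) powr (1 - a - 1)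
           * of_real (1 - t * (1 - x)) powr (- (c - a)))"
    unfolding e P exp_add[symmetric] by (rule arg_cong[where f = exp]) (simp add: algebra_simps)
next
  have "of_real x powr (1 - c) * of_real x powr (c - 1) = (1 :: complex)"
    using x unfolding powr_add[symmetric] by simp
  then show "w6 x a b c = of_real x powr (1 - c) * (of_real x powr (c - 1) * of_real \<bar>1 - x\<bar> powr (c - a - b)) *
      hyp2F1 (c - a) (c - b) (c - a - b + 1) (of_real (1 - x))"
    unfolding w6_def mult.assoc[symmetric] by (simp del: of_real_diff)
qed (use x re in auto)

(* Fourth item: the integral over (0,1) is a multiple of Beta b (1 - a), which converges for
   Re b > 0, Re a < 1. The source prints Gamma (-a) * Gamma (b + 1) with Re a < 0, Re b > -1
   instead; that is off by the factor -a/b (take c = b + 1), and the integral diverges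
   for Re b <= 0. *)
theorem mainTheorem17:
  fixes a b c :: complex
  assumes "generic a b c"
  shows
   "(\<forall>x\<in>{..<0} \<union> {0<..<1}. Re c > Re b \<and> Re b > 0 \<longrightarrow>
       has_integral_rep (w1 x a b c)
         (Gamma c / (Gamma b * Gamma (c - b)) * of_real \<bar>x\<bar> powr (1 - c))
         {y. 0 < y / x \<and> y / x < 1}
         (\<lambda>y. of_real \<bar>y\<bar> powr (b - 1) * of_real (1 - y) powr (- a)
                * of_real \<bar>x - y\<bar> powr (c - b - 1)))
  \<and> (\<forall>x\<in>{..<0} \<union> {0<..<1}. Re (c - 1) < Re a \<and> Re a < 1 \<longrightarrow>
       has_integral_rep (w2 x a b c)
         (Gamma (2 - c) / (Gamma (a - c + 1) * Gamma (1 - a)) * of_real \<bar>x\<bar> powr (1 - c))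
         {1<..}
         (\<lambda>y. of_real y powr (b - 1) * of_real (y - 1) powr (- a)
                * of_real (y - x) powr (c - b - 1)))
  \<and> (\<forall>x\<in>{..<0} \<union> {1<..}. Re (a - c + 1) > 0 \<and> Re (c - b) > 0 \<longrightarrow>
       has_integral_rep (w3 x a b c)
         (Gamma (a - b + 1) / (Gamma (a - c + 1) * Gamma (c - b)) * of_real \<bar>x\<bar> powr (1 - c))
         {y. y / x > 1}
         (\<lambda>y. of_real \<bar>y\<bar> powr (b - 1) * of_real \<bar>y - 1\<bar> powr (- a)
                * of_real \<bar>y - x\<bar> powr (c - b - 1)))
  \<and> (\<forall>x\<in>{..<0} \<union> {1<..}. Re a < 1 \<and> Re b > 0 \<longrightarrow>
       has_integral_rep (w4 x a b c)
         (Gamma (b - a + 1) / (Gamma (1 - a) * Gamma b) * of_real \<bar>x\<bar> powr (1 - c))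
         {0<..<1}
         (\<lambda>y. of_real y powr (b - 1) * of_real (1 - y) powr (- a)
                * of_real \<bar>x - y\<bar> powr (c - b - 1)))
  \<and> (\<forall>x\<in>{0<..}. Re b > 0 \<and> Re (a - c + 1) > 0 \<longrightarrow>
       has_integral_rep (w5 x a b c)
         (Gamma (a + b - c + 1) / (Gamma (a - c + 1) * Gamma b) * of_real x powr (1 - c))
         {..<0}
         (\<lambda>y. of_real (- y) powr (b - 1) * of_real (1 - y) powr (- a)
                * of_real (x - y) powr (c - b - 1)))
  \<and> (\<forall>x\<in>{0<..<1} \<union> {1<..}. Re (c - b) > 0 \<and> Re a < 1 \<longrightarrow>
       has_integral_rep (w6 x a b c)
         (Gamma (c - a - b + 1) / (Gamma (1 - a) * Gamma (c - b)) * of_real x powr (1 - c))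
         {y. 0 < (1 - y) / (1 - x) \<and> (1 - y) / (1 - x) < 1}
         (\<lambda>y. of_real y powr (b - 1) * of_real \<bar>1 - y\<bar> powr (- a)
                * of_real \<bar>x - y\<bar> powr (c - b - 1)))"
  by (intro conjI ballI impI hypergeo_integral_rep_w1 hypergeo_integral_rep_w2
        hypergeo_integral_rep_w3 hypergeo_integral_rep_w4 hypergeo_integral_rep_w5
        hypergeo_integral_rep_w6; auto)

end
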